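(* Let $r\ge 1$, let $X$ be an $(r+1)$-partite $r$-dimensional simplicial complex on vertex set $V$, and let $1\le k\le f_{r-1}(X)$. Then \[ \sum_{i=1}^{k} \lambda_i(L_{r-1}^{+}(X)) \le \sum_{i=1}^k \left| \{v\in V:\, \deg^{(r)}_X(v)\ge i\}\right|. \]
   Context: A simplicial complex $X$ on a finite vertex set $V$ is a family of subsets of $V$ closed under inclusion; its elements are called simplices (or faces), $\dim(\sigma)=|\sigma|-1$ for $\sigma\in X$, and $\dim(X)$ is the maximal dimension of a simplex. $X(i)$ is the set of $i$-dimensional simplices (with $X(-1)=\{\emptyset\}$; $X(0)$ is identified with $V$) and $f_i(X)=|X(i)|$. For $\sigma\in X$ and $1\le r\le\dim(X)$, the $r$-degree $\deg_X^{(r)}(\sigma)$ is the number of $r$-dimensional simplices of $X$ containing $\sigma$; for a vertex $v$, $\deg_X^{(r)}(v)$ is the number of $r$-dimensional simplices containing $v$. An $r$-dimensional simplicial complex $X$ is $(r+1)$-partite if there is a partition $V_1,\ldots,V_{r+1}$ of $V$ such that $|\sigma\cap V_i|\le 1$ for every $\sigma\in X$ and $1\le i\le r+1$. Fix an arbitrary linear order $<$ on $V$. For $\sigma\in X(s-1)$, $\tau\in X(s)$ with $\sigma\subset\tau$ ($0\le s\le \dim(X)$), let $u$ be the unique vertex of $\tau\setminus\sigma$ and set $(\tau:\sigma)=(-1)^{|\{v\in\tau:\,v<u\}|}$. For $1\le r\le\dim(X)$, the upper Laplacian $L_{r-1}^+(X)\in\mathbb{R}^{f_{r-1}(X)\times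 f_{r-1}(X)}$ is the matrix indexed by $X(r-1)$ with $L_{r-1}^+(X)_{\tau,\tau}=\deg_X^{(r)}(\tau)$; $L_{r-1}^+(X)_{\tau,\eta}=-(\tau:\tau\cap\eta)(\eta:\tau\cap\eta)$ if $|\tau\cap\eta|=r-1$ and $\tau\cup\eta\in X$; and all other entries $0$. For a symmetric real matrix $M$, $\lambda_i(M)$ is its $i$-th largest eigenvalue (with multiplicity). *)

theory Defs
  imports "HOL-Library.Disjoint_Sets" "HOL-Computational_Algebra.Polynomial"
    "Jordan_Normal_Form.Char_Poly"
begin

text \<open>
  The linear order on the vertices is the one of the type class \<open>linorder\<close>; any finite
  linearly ordered vertex set occurs as a subset of such a type.
\<close>

text \<open>Elements of \<open>V\<close> that are not themselves faces of \<open>X\<close> are permitted.\<close>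

definition simplicial_complex :: "'a set \<Rightarrow> 'a set set \<Rightarrow> bool" where
  "simplicial_complex V X \<longleftrightarrow>
     finite V \<and> X \<subseteq> Pow V \<and> {} \<in> X \<and> (\<forall>\<sigma>\<in>X. \<forall>\<tau>. \<tau> \<subseteq> \<sigma> \<longrightarrow> \<tau> \<in> X)"

definition simplex_dim :: "'a set \<Rightarrow> int" where
  "simplex_dim \<sigma> = int (card \<sigma>) - 1"

definition complex_dim :: "'a set set \<Rightarrow> int" where
  "complex_dim X = Max (simplex_dim ` X)"

definition simplices :: "'a set set \<Rightarrow> int \<Rightarrow> 'a set set" where
  "simplices X i = {\<sigma> \<in> X. simplex_dim \<sigma> = i}"

definition degree_of :: "'a set set \<Rightarrow> nat \<Rightarrow> 'a set \<Rightarrow> nat" where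
  "degree_of X r \<sigma> = card {\<tau> \<in> simplices X (int r). \<sigma> \<subseteq> \<tau>}"

text \<open>
  The blocks of \<open>partition_on\<close> are nonempty. For an \<open>(m - 1)\<close>-dimensional complex this is
  no restriction, as a face with \<open>m\<close> vertices meets each of the \<open>m\<close> blocks.
\<close>

definition partite :: "'a set \<Rightarrow> 'a set set \<Rightarrow> nat \<Rightarrow> bool" where
  "partite V X m \<longleftrightarrow>
     (\<exists>P. partition_on V P \<and> card P = m \<and> (\<forall>\<sigma>\<in>X. \<forall>A\<in>P. card (\<sigma> \<inter> A) \<le> 1))"

text \<open>The sign \<open>(\<tau> : \<sigma>)\<close>; meaningful when \<open>\<tau> - \<sigma>\<close> is a singleton.\<close>

definition incidence_sign :: "'a::linorder set \<Rightarrow> 'a set \<Rightarrow> real" where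
  "incidence_sign \<tau> \<sigma> = (-1) ^ card {v \<in> \<tau>. v < the_elem (\<tau> - \<sigma>)}"

text \<open>
  \<open>upper_laplacian X r\<close> has the entries of \<open>L\<^sup>+\<close> in dimension \<open>r - 1\<close> (so \<open>r \<ge> 1\<close>);
  its arguments \<open>\<tau>\<close>, \<open>\<eta>\<close> range over the \<open>(r - 1)\<close>-simplices of \<open>X\<close>.
\<close>

definition upper_laplacian :: "'a::linorder set set \<Rightarrow> nat \<Rightarrow> 'a set \<Rightarrow> 'a set \<Rightarrow> real" where
  "upper_laplacian X r \<tau> \<eta> =
     (if \<tau> = \<eta> then real (degree_of X r \<tau>)
      else if card (\<tau> \<inter> \<eta>) = r - 1 \<and> \<tau> \<union> \<eta> \<in> X
        then - (incidence_sign \<tau> (\<tau> \<inter> \<eta>) * incidence_sign \<eta> (\<tau> \<inter> \<eta>))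
      else 0)"

text \<open>The matrix of a kernel \<open>f\<close> whose rows and columns are indexed by the list \<open>xs\<close>.\<close>

definition mat_of_kernel :: "'b list \<Rightarrow> ('b \<Rightarrow> 'b \<Rightarrow> real) \<Rightarrow> real mat" where
  "mat_of_kernel xs f = mat (length xs) (length xs) (\<lambda>(i, j). f (xs ! i) (xs ! j))"

text \<open>
  The \<open>i\<close>-th largest eigenvalue, counted from \<open>i = 1\<close>, with algebraic multiplicity. For a
  symmetric real \<open>n \<times> n\<close> matrix all roots of the characteristic polynomial are real, so the list
  has length \<open>n\<close>.
\<close>

definition nth_largest_eigenvalue :: "real mat \<Rightarrow> nat \<Rightarrow> real" where
  "nth_largest_eigenvalue M i =
     rev (sorted_list_of_multiset (proots (char_poly M))) ! (i - 1)"

end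

theory Submission
  imports Defs "Jordan_Normal_Form.Spectral_Radius" "HOL-Combinatorics.List_Permutation"
begin

text \<open>
  Write the upper Laplacian as \<open>B B\<^sup>T\<close>, where \<open>B\<close> is the boundary matrix. If \<open>u\<^sub>j\<close> are orthonormal
  eigenvectors for the \<open>k\<close> largest eigenvalues, the normalised vectors \<open>w\<^sub>j\<close> proportional to
  \<open>B\<^sup>T u\<^sub>j\<close> are orthonormal functions on the \<open>r\<close>-simplices, and the sum of the eigenvalues is the sum
  over all \<open>(r - 1)\<close>-simplices \<open>\<tau>\<close> of \<open>deg(\<tau>) c(\<tau>)\<close>, where \<open>c(\<tau>)\<close> is the squared length of the
  projection of the normalised row \<open>B\<^sub>\<tau>\<close> to the span of the \<open>w\<^sub>j\<close>. Since \<open>deg(\<tau>)\<close> counts the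
  vertices \<open>v\<close> whose link contains \<open>\<tau>\<close>, this is the sum over \<open>v\<close> of the total \<open>c\<close>-weight of the
  link of \<open>v\<close>. Bessel's inequality gives \<open>c \<le> 1\<close>, so this weight is at most \<open>deg(v)\<close>. By
  partiteness an \<open>r\<close>-simplex has only one facet in the link of \<open>v\<close>, namely the one opposite to its
  vertex in the block of \<open>v\<close>; so the rows \<open>B\<^sub>\<tau>\<close> with \<open>\<tau>\<close> in the link have disjoint supports, and
  Bessel's inequality in the other direction bounds the weight by \<open>k\<close>. Finally, the sum over \<open>v\<close> of
  \<open>min (deg v) k\<close> is the right-hand side.
\<close>

section \<open>Spectral theorem for real symmetric matrices\<close>

lemma real_symmetric_mat_eigenvalue:
  fixes A :: "real mat"
  assumes A: "A \<in> carrier_mat n n" and sym: "transpose_mat A = A" and n: "n > 0"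
  obtains e where "eigenvalue A e"
proof -
  \<comment> \<open>An eigenvalue \<open>z\<close> exists over the complex numbers. Moving the
    symmetric real matrix across the Hermitian product of \<open>v\<close> with itself gives
    \<open>z = cnj z\<close>, so \<open>z\<close> is real and a root of the real characteristic
    polynomial.\<close>
  let ?C = "map_mat complex_of_real A"
  have C: "?C \<in> carrier_mat n n" using A by simp
  obtain z where z: "eigenvalue ?C z"
    using spectrum_non_empty[OF C n] by (auto simp: spectrum_def)
  then obtain v where v: "v \<in> carrier_vec n" "v \<noteq> 0\<^sub>v n" "?C *\<^sub>v v = z \<cdot>\<^sub>v v"
    using A by (auto simp: eigenvalue_def eigenvector_def)
  have symC: "transpose_mat ?C = ?C"
    using sym by (metis map_mat_transpose)
  have conj: "?C *\<^sub>v conjugate v = conjugate (?C *\<^sub>v v)"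
    using A v(1) by (intro eq_vecI) (auto simp: scalar_prod_def)
  have "z * (v \<bullet>c v) = (?C *\<^sub>v v) \<bullet>c v"
    using v by simp
  also have "\<dots> = v \<bullet> (?C *\<^sub>v conjugate v)"
    using transpose_vec_mult_scalar[OF C _ v(1), of "conjugate v"] v(1) symC
    by (metis C carrier_vec_conjugate comm_scalar_prod mult_mat_vec_carrier)
  also have "\<dots> = cnj z * (v \<bullet>c v)"
    using v by (simp add: conj conjugate_smult_vec)
  finally have "z = cnj z"
    using v conjugate_square_eq_0_vec by fastforce
  then obtain e where e: "z = complex_of_real e"
    by (metis Reals_cases Reals_cnj_iff)
  have "poly (map_poly complex_of_real (char_poly A)) z = 0"
    using z eigenvalue_root_char_poly[OF C] of_real_hom.char_poly_hom[OF A] by metis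
  then have "poly (char_poly A) e = 0"
    unfolding e by simp
  then show thesis
    using eigenvalue_root_char_poly[OF A] that by blast
qed

text \<open>Gram-Schmidt on a basis that begins with \<open>v\<close> leaves \<open>v\<close> in
  first place, and normalising the resulting vectors gives the columns. The scalar \<open>c\<close>
  stays unspecified because a multiple of an eigenvector still satisfies the eigenvector
  equation.\<close>

lemma orthogonal_mat_with_first_col:
  fixes v :: "real vec"
  assumes v: "v \<in> carrier_vec n" "v \<noteq> 0\<^sub>v n" and n: "n > 0"
  obtains W c where "W \<in> carrier_mat n n" "transpose_mat W * W = 1\<^sub>m n" "col W 0 = c \<cdot>\<^sub>v v"
proof -
  interpret vec_space "TYPE(real)" n .
  interpret cof_vec_space n "TYPE(real)" .
  define b where "b = basis_completion v"
  define ws where "ws = gram_schmidt n b"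
  note b = basis_completion[OF v, folded b_def]
  note ws = gram_schmidt_result[OF b(2,4,5) ws_def]
  have len: "length ws = n" using ws(4) b(6) by simp
  have hd: "ws ! 0 = v"
  proof -
    have "b = v # tl b" using b(6,7) n by (cases b) auto
    then have "hd ws = v" unfolding ws_def using gram_schmidt_hd[OF v(1), of "tl b"] by simp
    then show ?thesis using len n by (metis hd_conv_nth length_greater_0_conv)
  qed
  have wsc: "ws ! i \<in> carrier_vec n" if "i < n" for i
    using ws(3) that len by (metis nth_mem subsetD)
  \<comment> \<open>The equivalence carries two facts: distinct vectors are orthogonal, and for
    \<open>i = j\<close> the product is nonzero, which makes normalisation possible.\<close>
  have orth: "ws ! i \<bullet> ws ! j = 0 \<longleftrightarrow> i \<noteq> j" if "i < n" "j < n" for i j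
    using corthogonalD[OF ws(2), of i j] that len by simp
  have pos: "ws ! i \<bullet> ws ! i > 0" if "i < n" for i
  proof -
    have "ws ! i \<bullet> ws ! i \<ge> 0" by (simp add: scalar_prod_def sum_nonneg)
    then show ?thesis using orth[OF that that] by linarith
  qed
  define us where "us = map (\<lambda>w. (1 / sqrt (w \<bullet> w)) \<cdot>\<^sub>v w) ws"
  define W where "W = mat_of_cols n us"
  have W: "W \<in> carrier_mat n n"
    unfolding W_def using len mat_of_cols_carrier(1)[of n us] by (simp add: us_def)
  have colW: "col W i = (1 / sqrt (ws ! i \<bullet> ws ! i)) \<cdot>\<^sub>v ws ! i" if "i < n" for i
    unfolding W_def using that len wsc[OF that] by (subst col_mat_of_cols) (auto simp: us_def)
  have "transpose_mat W * W = 1\<^sub>m n"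
  proof (rule eq_matI)
    fix i j assume "i < dim_row (1\<^sub>m n)" "j < dim_col (1\<^sub>m n)"
    then have ij: "i < n" "j < n" by auto
    have "(transpose_mat W * W) $$ (i, j) = col W i \<bullet> col W j"
      using W ij by simp
    also have "\<dots> = (1 / sqrt (ws ! i \<bullet> ws ! i)) * (1 / sqrt (ws ! j \<bullet> ws ! j)) * (ws ! i \<bullet> ws ! j)"
      using wsc[OF ij(1)] wsc[OF ij(2)] ij by (simp add: colW)
    also have "\<dots> = 1\<^sub>m n $$ (i, j)"
      using ij pos[of i] orth[of i j] by auto
    finally show "(transpose_mat W * W) $$ (i, j) = 1\<^sub>m n $$ (i, j)" .
  qed (use W in auto)
  then show thesis using that W colW[OF n] hd by metis
qed

text \<open>Induction by deflation: in an orthonormal basis starting with an eigenvector, the matrix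
  splits into a one-by-one block and a smaller symmetric block, to which the induction hypothesis
  applies.\<close>

theorem real_symmetric_mat_diagonalization:
  fixes A :: "real mat"
  assumes "A \<in> carrier_mat n n" and "transpose_mat A = A"
  shows "\<exists>U D. U \<in> carrier_mat n n \<and> D \<in> carrier_mat n n \<and> transpose_mat U * U = 1\<^sub>m n
    \<and> diagonal_mat D \<and> transpose_mat U * A * U = D"
  using assms
proof (induction n arbitrary: A)
  case 0
  then show ?case
    by (intro exI[of _ "1\<^sub>m 0"] exI[of _ A]) (auto simp: diagonal_mat_def)
next
  case (Suc m)
  note A = Suc.prems(1)
  obtain e where "eigenvalue A e"
    using real_symmetric_mat_eigenvalue[OF Suc.prems] by blast
  then obtain v where v: "v \<in> carrier_vec (Suc m)" "v \<noteq> 0\<^sub>v (Suc m)" and Av: "A *\<^sub>v v = e \<cdot>\<^sub>v v"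
    using A by (auto simp: eigenvalue_def eigenvector_def)
  obtain W c where W: "W \<in> carrier_mat (Suc m) (Suc m)"
    and WW: "transpose_mat W * W = 1\<^sub>m (Suc m)" and col: "col W 0 = c \<cdot>\<^sub>v v"
    using orthogonal_mat_with_first_col[OF v] by blast
  let ?Wt = "transpose_mat W"
  have Wt: "?Wt \<in> carrier_mat (Suc m) (Suc m)" using W by simp
  define A' where "A' = ?Wt * A * W"
  have A': "A' \<in> carrier_mat (Suc m) (Suc m)" unfolding A'_def using A W by simp
  have A'sym: "transpose_mat A' = A'"
    unfolding A'_def using A W Wt Suc.prems(2)
    by (simp add: transpose_mult[of _ "Suc m" "Suc m" _ "Suc m"])
  \<comment> \<open>The first column of \<open>W\<close> is an eigenvector, so the first column of
    \<open>A'\<close> is \<open>e\<close> times the first column of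
    \<open>transpose_mat W * W\<close>, a unit vector.\<close>
  have A'0: "A' $$ (i, 0) = (if i = 0 then e else 0)" if i: "i < Suc m" for i
  proof -
    have "A *\<^sub>v col W 0 = e \<cdot>\<^sub>v col W 0"
      using A v(1) by (simp add: col mult_mat_vec Av smult_smult_assoc mult.commute)
    moreover have "A' = ?Wt * (A * W)"
      unfolding A'_def using A W Wt by simp
    ultimately have "A' $$ (i, 0) = col W i \<bullet> (e \<cdot>\<^sub>v col W 0)"
      using i A W by (simp add: col_mult2[of A "Suc m" "Suc m" W "Suc m"] del: col_mult)
    also have "\<dots> = e * (?Wt * W) $$ (i, 0)"
      using i W by (simp add: scalar_prod_smult_distrib[of _ "Suc m"])
    finally show ?thesis
      using i by (simp add: WW)
  qed
  have A'0': "A' $$ (0, j) = (if j = 0 then e else 0)" if j: "j < Suc m" for j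
    using A'0[OF j] A' j by (subst A'sym[symmetric]) simp
  define A3 where "A3 = mat m m (\<lambda>(i, j). A' $$ (Suc i, Suc j))"
  have A3: "A3 \<in> carrier_mat m m" unfolding A3_def by simp
  let ?E = "mat 1 1 (\<lambda>_. e)"
  have A'block: "A' = four_block_mat ?E (0\<^sub>m 1 m) (0\<^sub>m m 1) A3"
    by (rule eq_matI) (use A' A'0 A'0' in \<open>auto simp: A3_def\<close>)
  have "transpose_mat A3 = A3"
  proof (rule eq_matI)
    fix i j assume "i < dim_row A3" "j < dim_col A3"
    then have ij: "i < m" "j < m" by (auto simp: A3_def)
    have "A' $$ (Suc j, Suc i) = transpose_mat A' $$ (Suc i, Suc j)"
      using ij A' by simp
    then show "transpose_mat A3 $$ (i, j) = A3 $$ (i, j)"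
      using ij by (simp add: A3_def A'sym)
  qed (auto simp: A3_def)
  from Suc.IH[OF A3 this] obtain U D where U: "U \<in> carrier_mat m m" and D: "D \<in> carrier_mat m m"
    and UU: "transpose_mat U * U = 1\<^sub>m m" and diag: "diagonal_mat D"
    and UAU: "transpose_mat U * A3 * U = D"
    by blast
  \<comment> \<open>The diagonalising matrix of the small block is extended by a 1 in the corner,
    which fixes the eigenvector already split off; \<open>W * Q\<close> then diagonalises
    \<open>A\<close>.\<close>
  define Q where "Q = four_block_mat (1\<^sub>m 1) (0\<^sub>m 1 m) (0\<^sub>m m 1) U"
  define D' where "D' = four_block_mat ?E (0\<^sub>m 1 m) (0\<^sub>m m 1) D"
  have Q: "Q \<in> carrier_mat (Suc m) (Suc m)" and D': "D' \<in> carrier_mat (Suc m) (Suc m)"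
    using U D by (auto simp: Q_def D'_def)
  have Qt: "transpose_mat Q = four_block_mat (1\<^sub>m 1) (0\<^sub>m 1 m) (0\<^sub>m m 1) (transpose_mat U)"
    unfolding Q_def using U by (subst transpose_four_block_mat) auto
  have QQ: "transpose_mat Q * Q = 1\<^sub>m (Suc m)"
    unfolding Qt unfolding Q_def
    using U UU by (subst mult_four_block_mat[of _ 1 1 _ m _ m _ _ 1 _ m]) auto
  have "transpose_mat Q * A' = four_block_mat ?E (0\<^sub>m 1 m) (0\<^sub>m m 1) (transpose_mat U * A3)"
    unfolding Qt A'block
    using U A3 by (subst mult_four_block_mat[of _ 1 1 _ m _ m _ _ 1 _ m]) auto
  also have "\<dots> * Q = D'"
    unfolding D'_def Q_def
    using U A3 UAU by (subst mult_four_block_mat[of _ 1 1 _ m _ m _ _ 1 _ m]) auto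
  finally have QAQ: "transpose_mat Q * A' * Q = D'" .
  have Qc: "transpose_mat Q \<in> carrier_mat (Suc m) (Suc m)" using Q by simp
  have WQt: "transpose_mat (W * Q) = transpose_mat Q * ?Wt"
    using W Q by (rule transpose_mult)
  have "transpose_mat (W * Q) * (W * Q) = transpose_mat Q * (?Wt * W) * Q"
    unfolding WQt using W Wt Q Qc by (simp add: assoc_mult_mat[of _ "Suc m" "Suc m" _ "Suc m" _ "Suc m"])
  then have 1: "transpose_mat (W * Q) * (W * Q) = 1\<^sub>m (Suc m)"
    using Qc QQ WW by simp
  have "transpose_mat (W * Q) * A * (W * Q) = transpose_mat Q * A' * Q"
    unfolding WQt A'_def using A W Wt Q Qc
    by (simp add: assoc_mult_mat[of _ "Suc m" "Suc m" _ "Suc m" _ "Suc m"])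
  then have 2: "transpose_mat (W * Q) * A * (W * Q) = D'"
    by (simp add: QAQ)
  have 3: "diagonal_mat D'"
    using D diag by (auto simp: D'_def diagonal_mat_def)
  show ?case
    using W Q D' 1 2 3 by (intro exI[of _ "W * Q"] exI[of _ D']) simp
qed

section \<open>Ordered eigenvalues and an orthonormal eigenbasis of a symmetric kernel\<close>

lemma mat_of_kernel_carrier [simp]: "mat_of_kernel xs f \<in> carrier_mat (length xs) (length xs)"
  by (simp add: mat_of_kernel_def)

lemma proots_prod_list_linear: "proots (\<Prod>a\<leftarrow>as. [:- a, 1:]) = mset (as :: 'a::idom list)"
proof -
  have "proots (\<Prod>a\<leftarrow>as. [:- a, 1:]) = (\<Sum>a\<leftarrow>as. {#a#})"
    using proots_prod_list[of "map (\<lambda>a. [:- a, 1:]) as"] by (simp add: o_def image_iff)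
  also have "\<dots> = mset as"
    by (induction as) auto
  finally show ?thesis .
qed

text \<open>Translates the diagonalization into sums over the index set itself, free of list
  positions, and pairs each eigenvector with its eigenvalue in decreasing order.\<close>

theorem symmetric_kernel_eigenbasis:
  fixes f :: "'b \<Rightarrow> 'b \<Rightarrow> real"
  assumes dist: "distinct xs" and sym: "\<And>x y. x \<in> set xs \<Longrightarrow> y \<in> set xs \<Longrightarrow> f x y = f y x"
  obtains u :: "nat \<Rightarrow> 'b \<Rightarrow> real" where
    "\<And>i j. i \<in> {1..length xs} \<Longrightarrow> j \<in> {1..length xs} \<Longrightarrow>
       (\<Sum>x\<in>set xs. u i x * u j x) = (if i = j then 1 else 0)"
    "\<And>i x. i \<in> {1..length xs} \<Longrightarrow> x \<in> set xs \<Longrightarrow>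
       (\<Sum>y\<in>set xs. f x y * u i y) = nth_largest_eigenvalue (mat_of_kernel xs f) i * u i x"
proof -
  define n where "n = length xs"
  define A where "A = mat_of_kernel xs f"
  have A: "A \<in> carrier_mat n n" by (simp add: A_def n_def)
  have "transpose_mat A = A"
    by (rule eq_matI) (auto simp: A_def mat_of_kernel_def sym)
  then obtain U D where U: "U \<in> carrier_mat n n" and D: "D \<in> carrier_mat n n"
    and UU: "transpose_mat U * U = 1\<^sub>m n" and diag: "diagonal_mat D"
    and UAU: "transpose_mat U * A * U = D"
    using real_symmetric_mat_diagonalization[OF A] by blast
  have Ut: "transpose_mat U \<in> carrier_mat n n" using U by simp
  have UU': "U * transpose_mat U = 1\<^sub>m n"
    using mat_mult_left_right_inverse[OF Ut U UU] .
  have "U * D = (U * transpose_mat U) * (A * U)"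
    unfolding UAU[symmetric] using U Ut A by (simp add: assoc_mult_mat[of _ n n _ n _ n])
  then have AU: "A * U = U * D"
    using A U by (simp add: UU')
  have "A = A * (U * transpose_mat U)"
    using A by (simp add: UU')
  then have "A = U * D * transpose_mat U"
    using A U Ut AU by (simp add: assoc_mult_mat[of _ n n _ n _ n, symmetric])
  then have "similar_mat A D"
    using A D U Ut UU UU' by (intro similar_matI[of _ _ _ _ n]) auto
  then have "char_poly A = char_poly D"
    by (rule char_poly_similar)
  also have "\<dots> = (\<Prod>a\<leftarrow>diag_mat D. [:- a, 1:])"
    using D diag by (intro char_poly_upper_triangular[OF D]) (auto simp: diagonal_mat_def)
  finally have roots: "proots (char_poly A) = mset (diag_mat D)"
    by (simp add: proots_prod_list_linear)
  define es where "es = rev (sorted_list_of_multiset (proots (char_poly A)))"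
  have "mset es = mset (diag_mat D)"
    by (simp add: es_def roots)
  \<comment> \<open>The sorted eigenvalues and the diagonal of \<open>D\<close> are the same
    multiset, so a permutation tells which column of \<open>U\<close> belongs to the eigenvalue at a
    given sorted position.\<close>
  then obtain \<pi> where \<pi>: "bij_betw \<pi> {..<length es} {..<length (diag_mat D)}"
    and es: "\<And>i. i < length es \<Longrightarrow> es ! i = diag_mat D ! \<pi> i"
    using permutation_Ex_bij by blast
  have len': "length (diag_mat D) = n"
    using D by (simp add: diag_mat_def)
  then have len: "length es = n"
    using mset_eq_length[OF \<open>mset es = mset (diag_mat D)\<close>] by simp
  have \<pi>n: "\<pi> i < n" if "i < n" for i
    using bij_betwE[OF \<pi>] that by (simp add: len len')
  have \<pi>inj: "\<pi> i = \<pi> j \<longleftrightarrow> i = j" if "i < n" "j < n" for i j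
    using bij_betw_imp_inj_on[OF \<pi>] that by (auto simp: len inj_on_def)
  have ev: "nth_largest_eigenvalue A i = D $$ (\<pi> (i - 1), \<pi> (i - 1))" if "i \<in> {1..n}" for i
  proof -
    have "i - 1 < n" using that by auto
    then show ?thesis
      using es[of "i - 1"] \<pi>n[of "i - 1"] D
      by (simp add: nth_largest_eigenvalue_def es_def[symmetric] len diag_mat_def)
  qed
  define ix where "ix = the_inv_into {..<n} ((!) xs)"
  have inj: "inj_on ((!) xs) {..<n}"
    using dist by (auto simp: n_def inj_on_def nth_eq_iff_index_eq)
  have ix: "ix (xs ! i) = i" if "i < n" for i
    unfolding ix_def using the_inv_into_f_f[OF inj] that by simp
  have reindex: "(\<Sum>x\<in>set xs. g x) = (\<Sum>i<n. g (xs ! i))" for g :: "'b \<Rightarrow> real"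
    using sum.reindex_bij_betw[OF bij_betw_nth[OF dist refl refl], of g] by (simp add: n_def)
  \<comment> \<open>Here \<open>ix\<close> turns an element back into its row number. The shift
    \<open>i - 1\<close> reconciles eigenvalues counted from 1 with list positions counted from
    0.\<close>
  define u where "u i x = U $$ (ix x, \<pi> (i - 1))" for i x
  show thesis
  proof (rule that[of u]; unfold n_def[symmetric] A_def[symmetric])
    fix i j assume ij: "i \<in> {1..n}" "j \<in> {1..n}"
    then have ij': "i - 1 < n" "j - 1 < n" by auto
    have "(\<Sum>x\<in>set xs. u i x * u j x) = (\<Sum>l<n. U $$ (l, \<pi> (i - 1)) * U $$ (l, \<pi> (j - 1)))"
      by (simp add: reindex u_def ix)
    also have "\<dots> = (transpose_mat U * U) $$ (\<pi> (i - 1), \<pi> (j - 1))"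
      using U \<pi>n[OF ij'(1)] \<pi>n[OF ij'(2)] by (simp add: scalar_prod_def atLeast0LessThan)
    also have "\<dots> = (if i = j then 1 else 0)"
      using \<pi>n[OF ij'(1)] \<pi>n[OF ij'(2)] \<pi>inj[OF ij'] ij by (auto simp: UU)
    finally show "(\<Sum>x\<in>set xs. u i x * u j x) = (if i = j then 1 else 0)" .
  next
    fix i x assume i: "i \<in> {1..n}" and x: "x \<in> set xs"
    then obtain l where l: "l < n" "x = xs ! l"
      by (metis in_set_conv_nth n_def)
    let ?j = "\<pi> (i - 1)"
    have j: "?j < n" using \<pi>n i by auto
    have "(\<Sum>y\<in>set xs. f x y * u i y) = (\<Sum>k<n. A $$ (l, k) * U $$ (k, ?j))"
      using l by (simp add: reindex u_def ix A_def mat_of_kernel_def n_def)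
    also have "\<dots> = (A * U) $$ (l, ?j)"
      using A U l j by (simp add: scalar_prod_def atLeast0LessThan)
    also have "\<dots> = (\<Sum>k<n. U $$ (l, k) * D $$ (k, ?j))"
      using D U l j by (simp add: AU scalar_prod_def atLeast0LessThan)
    also have "\<dots> = (\<Sum>k<n. if k = ?j then U $$ (l, k) * D $$ (k, k) else 0)"
      using diag D j by (intro sum.cong) (auto simp: diagonal_mat_def)
    also have "\<dots> = nth_largest_eigenvalue A i * u i x"
      using j l by (simp add: ev[OF i] u_def ix)
    finally show "(\<Sum>y\<in>set xs. f x y * u i y) = nth_largest_eigenvalue A i * u i x" .
  qed
qed

section \<open>Bessel's inequality and an eigenvalue bound for Gram matrices\<close>

lemma bessel_inequality_sum:
  fixes x :: "'b \<Rightarrow> real" and w :: "'j \<Rightarrow> 'b \<Rightarrow> real"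
  assumes "finite F" "finite J"
    and orth: "\<And>i j. i \<in> J \<Longrightarrow> j \<in> J \<Longrightarrow> (\<Sum>s\<in>F. w i s * w j s) = (if i = j then 1 else 0)"
  shows "(\<Sum>j\<in>J. (\<Sum>s\<in>F. x s * w j s)\<^sup>2) \<le> (\<Sum>s\<in>F. (x s)\<^sup>2)"
proof -
  define c where "c j = (\<Sum>s\<in>F. x s * w j s)" for j
  \<comment> \<open>The orthogonal projection of \<open>x\<close> to the span of the
    \<open>w j\<close>. Both the product of \<open>x\<close> with \<open>p\<close> and that of
    \<open>p\<close> with itself equal the sum of the \<open>(c j)\<^sup>2\<close>, so the claim is
    that \<open>x - p\<close> has nonnegative squared length.\<close>
  define p where "p s = (\<Sum>j\<in>J. c j * w j s)" for s
  have xp: "(\<Sum>s\<in>F. x s * p s) = (\<Sum>j\<in>J. (c j)\<^sup>2)"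
  proof -
    have "(\<Sum>s\<in>F. x s * p s) = (\<Sum>j\<in>J. \<Sum>s\<in>F. x s * (c j * w j s))"
      unfolding p_def sum_distrib_left by (rule sum.swap)
    also have "\<dots> = (\<Sum>j\<in>J. (c j)\<^sup>2)"
      by (simp add: c_def power2_eq_square sum_distrib_left mult_ac)
    finally show ?thesis .
  qed
  have wp: "(\<Sum>s\<in>F. w i s * p s) = c i" if i: "i \<in> J" for i
  proof -
    have "(\<Sum>s\<in>F. w i s * p s) = (\<Sum>j\<in>J. \<Sum>s\<in>F. w i s * (c j * w j s))"
      unfolding p_def sum_distrib_left by (rule sum.swap)
    also have "\<dots> = (\<Sum>j\<in>J. c j * (\<Sum>s\<in>F. w i s * w j s))"
      by (simp add: sum_distrib_left mult_ac)
    also have "\<dots> = (\<Sum>j\<in>J. if i = j then c j else 0)"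
      using i by (intro sum.cong) (auto simp: orth)
    also have "\<dots> = c i"
      using i \<open>finite J\<close> by simp
    finally show ?thesis .
  qed
  have pp: "(\<Sum>s\<in>F. p s * p s) = (\<Sum>j\<in>J. (c j)\<^sup>2)"
  proof -
    have "(\<Sum>s\<in>F. p s * p s) = (\<Sum>j\<in>J. \<Sum>s\<in>F. (c j * w j s) * p s)"
      unfolding p_def sum_distrib_right by (rule sum.swap)
    also have "\<dots> = (\<Sum>j\<in>J. c j * (\<Sum>s\<in>F. w j s * p s))"
      by (simp add: sum_distrib_left mult_ac)
    also have "\<dots> = (\<Sum>j\<in>J. (c j)\<^sup>2)"
      by (simp add: wp power2_eq_square)
    finally show ?thesis .
  qed
  have "0 \<le> (\<Sum>s\<in>F. (x s - p s)\<^sup>2)"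
    by (simp add: sum_nonneg)
  also have "\<dots> = (\<Sum>s\<in>F. (x s)\<^sup>2) - 2 * (\<Sum>s\<in>F. x s * p s) + (\<Sum>s\<in>F. p s * p s)"
    by (simp add: power2_eq_square algebra_simps sum.distrib sum_subtractf sum_distrib_left)
  finally show ?thesis
    by (simp add: xp pp c_def)
qed

text \<open>The transpose of \<open>b\<close> sends the orthonormal eigenvectors \<open>u j\<close>
  to pairwise orthogonal vectors \<open>z j\<close> of squared length \<open>ev j\<close>. Applying
  \<open>b\<close> to the normalised \<open>w j\<close> gives \<open>sqrt (ev j)\<close> times
  \<open>u j\<close>, whose squared length is again \<open>ev j\<close>.\<close>

lemma gram_eigenvectors_transfer:
  fixes b :: "'e \<Rightarrow> 'f \<Rightarrow> real" and u :: "'j \<Rightarrow> 'e \<Rightarrow> real"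
  assumes "finite E" "finite F" "finite J"
    and orth: "\<And>i j. i \<in> J \<Longrightarrow> j \<in> J \<Longrightarrow> (\<Sum>x\<in>E. u i x * u j x) = (if i = j then 1 else 0)"
    and eigen: "\<And>j x. j \<in> J \<Longrightarrow> x \<in> E \<Longrightarrow>
      (\<Sum>y\<in>E. (\<Sum>s\<in>F. b x s * b y s) * u j y) = ev j * u j x"
  obtains K w where "K \<subseteq> J"
    "\<And>i j. i \<in> K \<Longrightarrow> j \<in> K \<Longrightarrow> (\<Sum>s\<in>F. w i s * w j s) = (if i = j then 1 else 0 :: real)"
    "(\<Sum>j\<in>J. ev j) = (\<Sum>j\<in>K. \<Sum>x\<in>E. (\<Sum>s\<in>F. b x s * w j s)\<^sup>2)"
proof -
  define z where "z j s = (\<Sum>y\<in>E. b y s * u j y)" for j s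
  have bz: "(\<Sum>s\<in>F. b x s * z j s) = ev j * u j x" if "j \<in> J" "x \<in> E" for j x
  proof -
    have "(\<Sum>s\<in>F. b x s * z j s) = (\<Sum>y\<in>E. \<Sum>s\<in>F. b x s * (b y s * u j y))"
      unfolding z_def sum_distrib_left by (rule sum.swap)
    also have "\<dots> = (\<Sum>y\<in>E. (\<Sum>s\<in>F. b x s * b y s) * u j y)"
      by (simp add: sum_distrib_right mult.assoc)
    finally show ?thesis
      using eigen[OF that] by simp
  qed
  have zz: "(\<Sum>s\<in>F. z i s * z j s) = (if i = j then ev j else 0)" if "i \<in> J" "j \<in> J" for i j
  proof -
    have "(\<Sum>s\<in>F. z i s * z j s) = (\<Sum>x\<in>E. \<Sum>s\<in>F. b x s * u i x * z j s)"
      unfolding z_def[of i] sum_distrib_right by (rule sum.swap)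
    also have "\<dots> = (\<Sum>x\<in>E. u i x * (\<Sum>s\<in>F. b x s * z j s))"
      by (simp add: sum_distrib_left mult_ac)
    also have "\<dots> = ev j * (\<Sum>x\<in>E. u i x * u j x)"
      using that by (simp add: bz sum_distrib_left mult_ac)
    finally show ?thesis
      using that by (simp add: orth)
  qed
  have ev_nonneg: "ev j \<ge> 0" if "j \<in> J" for j
    using zz[OF that that] sum_nonneg[of F "\<lambda>s. z j s * z j s"] by simp
  \<comment> \<open>Each eigenvalue is a squared length, hence nonnegative. Those equal to 0 are
    discarded: their \<open>z j\<close> cannot be normalised, and they add nothing to the
    sum.\<close>
  define K where "K = {j \<in> J. ev j > 0}"
  define w where "w j s = z j s / sqrt (ev j)" for j s
  show thesis
  proof (rule that[of K w])
    show "K \<subseteq> J" by (auto simp: K_def)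
    show "(\<Sum>s\<in>F. w i s * w j s) = (if i = j then 1 else 0)" if "i \<in> K" "j \<in> K" for i j
    proof -
      have "(\<Sum>s\<in>F. w i s * w j s) = (\<Sum>s\<in>F. z i s * z j s) / (sqrt (ev i) * sqrt (ev j))"
        by (simp add: w_def sum_divide_distrib)
      then show ?thesis
        using that by (auto simp: zz K_def)
    qed
    have "(\<Sum>x\<in>E. (\<Sum>s\<in>F. b x s * w j s)\<^sup>2) = ev j" if "j \<in> K" for j
    proof -
      have j: "j \<in> J" "ev j > 0" using that by (auto simp: K_def)
      have "(\<Sum>s\<in>F. b x s * w j s) = ev j * u j x / sqrt (ev j)" if "x \<in> E" for x
        using bz[OF j(1) that] by (simp add: w_def flip: sum_divide_distrib)
      then have "(\<Sum>x\<in>E. (\<Sum>s\<in>F. b x s * w j s)\<^sup>2) = (\<Sum>x\<in>E. ev j * (u j x * u j x))"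
        using j(2) by (simp add: power_divide power_mult_distrib) (simp add: power2_eq_square)
      also have "\<dots> = ev j"
        using orth[OF j(1) j(1)] by (simp flip: sum_distrib_left)
      finally show ?thesis .
    qed
    moreover have "(\<Sum>j\<in>J. ev j) = (\<Sum>j\<in>K. ev j)"
      using \<open>finite J\<close> ev_nonneg by (intro sum.mono_neutral_right) (force simp: K_def)+
    ultimately show "(\<Sum>j\<in>J. ev j) = (\<Sum>j\<in>K. \<Sum>x\<in>E. (\<Sum>s\<in>F. b x s * w j s)\<^sup>2)"
      by simp
  qed
qed

text \<open>The spectral argument with the topology stripped off: \<open>E\<close> and
  \<open>F\<close> stand for the simplices of dimensions \<open>r - 1\<close> and \<open>r\<close>,
  \<open>b\<close> for the boundary matrix, and \<open>T v\<close> for the link of \<open>v\<close>.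
  The assumption \<open>disj\<close> is where partiteness enters.\<close>

theorem sum_gram_eigenvalues_le_sum_min:
  fixes b :: "'e \<Rightarrow> 'f \<Rightarrow> real" and u :: "'j \<Rightarrow> 'e \<Rightarrow> real" and T :: "'v \<Rightarrow> 'e set"
  assumes fin: "finite E" "finite F" "finite J" "finite V"
    and orth: "\<And>i j. i \<in> J \<Longrightarrow> j \<in> J \<Longrightarrow> (\<Sum>x\<in>E. u i x * u j x) = (if i = j then 1 else 0)"
    and eigen: "\<And>j x. j \<in> J \<Longrightarrow> x \<in> E \<Longrightarrow>
      (\<Sum>y\<in>E. (\<Sum>s\<in>F. b x s * b y s) * u j y) = ev j * u j x"
    and unit: "\<And>x s. x \<in> E \<Longrightarrow> s \<in> F \<Longrightarrow> b x s \<in> {-1, 0, 1}"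
    and T: "\<And>v. v \<in> V \<Longrightarrow> T v \<subseteq> E"
    and disj: "\<And>v s x y. v \<in> V \<Longrightarrow> s \<in> F \<Longrightarrow> x \<in> T v \<Longrightarrow> y \<in> T v \<Longrightarrow>
      b x s \<noteq> 0 \<Longrightarrow> b y s \<noteq> 0 \<Longrightarrow> x = y"
    and count: "\<And>x. x \<in> E \<Longrightarrow> card {s \<in> F. b x s \<noteq> 0} = card {v \<in> V. x \<in> T v}"
  shows "(\<Sum>j\<in>J. ev j) \<le> (\<Sum>v\<in>V. real (min (card (T v)) (card J)))"
proof -
  obtain K w where K: "K \<subseteq> J"
    and w: "\<And>i j. i \<in> K \<Longrightarrow> j \<in> K \<Longrightarrow> (\<Sum>s\<in>F. w i s * w j s) = (if i = j then 1 else 0 :: real)"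
    and ev: "(\<Sum>j\<in>J. ev j) = (\<Sum>j\<in>K. \<Sum>x\<in>E. (\<Sum>s\<in>F. b x s * w j s)\<^sup>2)"
    using gram_eigenvectors_transfer[OF fin(1-3) orth eigen] by blast
  have finK: "finite K" using K fin(3) by (rule finite_subset)
  \<comment> \<open>For a row \<open>x\<close> of \<open>b\<close>, \<open>d x\<close> is its
    squared length, \<open>a x\<close> that of its projection to the span of the \<open>w j\<close>,
    and \<open>c x\<close> their ratio. For a zero row the division by 0 yields
    \<open>c x = 0\<close>, which keeps \<open>a x = d x * c x\<close> valid.\<close>
  define d where "d x = real (card {s \<in> F. b x s \<noteq> 0})" for x
  define a where "a x = (\<Sum>j\<in>K. (\<Sum>s\<in>F. b x s * w j s)\<^sup>2)" for x
  define c where "c x = a x / d x" for x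
  have d: "(\<Sum>s\<in>F. b x s * b x s) = d x" if "x \<in> E" for x
  proof -
    have "(\<Sum>s\<in>F. b x s * b x s) = (\<Sum>s\<in>F. if b x s \<noteq> 0 then 1 else 0)"
    proof (intro sum.cong refl)
      fix s assume "s \<in> F"
      then show "b x s * b x s = (if b x s \<noteq> 0 then 1 else 0)"
        using unit[OF that, of s] by auto
    qed
    also have "\<dots> = d x"
      using fin(2) by (simp add: d_def sum.If_cases Int_def)
    finally show ?thesis .
  qed
  have a_nonneg: "a x \<ge> 0" for x by (simp add: a_def sum_nonneg)
  have d_nonneg: "d x \<ge> 0" for x by (simp add: d_def)
  have a_le: "a x \<le> d x" if "x \<in> E" for x
    using bessel_inequality_sum[OF fin(2) finK w, of "b x"] d[OF that]
    by (simp add: a_def power2_eq_square)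
  have a_eq: "a x = d x * c x" if "x \<in> E" for x
    using a_le[OF that] a_nonneg[of x] by (cases "d x = 0") (auto simp: c_def)
  have c_le: "c x \<le> 1" if "x \<in> E" for x
    using a_le[OF that] d_nonneg[of x] by (cases "d x = 0") (auto simp: c_def field_simps)
  have T_le: "(\<Sum>x\<in>T v. c x) \<le> real (min (card (T v)) (card J))" if v: "v \<in> V" for v
  proof -
    have finT: "finite (T v)" using T[OF v] fin(1) by (rule finite_subset)
    have "(\<Sum>x\<in>T v. c x) \<le> (\<Sum>x\<in>T v. 1)"
      using T[OF v] c_le by (intro sum_mono) auto
    then have 1: "(\<Sum>x\<in>T v. c x) \<le> real (card (T v))" by simp
    \<comment> \<open>Zero rows cannot be normalised and have weight 0, so they are left out. The
      remaining normalised rows are orthonormal because their supports are disjoint.\<close>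
    define T' where "T' = {x \<in> T v. d x > 0}"
    have finT': "finite T'" using finT by (simp add: T'_def)
    define y where "y x s = b x s / sqrt (d x)" for x s
    have y_orth: "(\<Sum>s\<in>F. y x s * y x' s) = (if x = x' then 1 else 0)"
      if xx: "x \<in> T'" "x' \<in> T'" for x x'
    proof (cases "x = x'")
      case True
      have "(\<Sum>s\<in>F. y x s * y x s) = (\<Sum>s\<in>F. b x s * b x s) / d x"
        using xx by (simp add: y_def sum_divide_distrib T'_def)
      also have "\<dots> = 1"
        using xx T[OF v] d[of x] by (auto simp: T'_def)
      finally show ?thesis using True by simp
    next
      case False
      have "y x s * y x' s = 0" if "s \<in> F" for s
        using disj[OF v that, of x x'] xx False by (auto simp: y_def T'_def)
      then have "(\<Sum>s\<in>F. y x s * y x' s) = 0" by (rule sum.neutral[OF ballI])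
      then show ?thesis using False by simp
    qed
    have "(\<Sum>x\<in>T v. c x) = (\<Sum>x\<in>T'. c x)"
    proof (intro sum.mono_neutral_right ballI)
      fix x assume "x \<in> T v - T'"
      then have "d x = 0" using d_nonneg[of x] by (auto simp: T'_def)
      then show "c x = 0" by (simp add: c_def)
    qed (use finT in \<open>auto simp: T'_def\<close>)
    also have "\<dots> = (\<Sum>x\<in>T'. \<Sum>j\<in>K. (\<Sum>s\<in>F. w j s * y x s)\<^sup>2)"
    proof (intro sum.cong refl)
      fix x assume x: "x \<in> T'"
      have "(\<Sum>s\<in>F. w j s * y x s) = (\<Sum>s\<in>F. b x s * w j s) / sqrt (d x)" for j
        by (simp add: y_def sum_divide_distrib mult.commute)
      then show "c x = (\<Sum>j\<in>K. (\<Sum>s\<in>F. w j s * y x s)\<^sup>2)"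
        using x by (simp add: c_def a_def power_divide T'_def flip: sum_divide_distrib)
    qed
    also have "\<dots> = (\<Sum>j\<in>K. \<Sum>x\<in>T'. (\<Sum>s\<in>F. w j s * y x s)\<^sup>2)"
      by (rule sum.swap)
    \<comment> \<open>Bessel's inequality with the roles exchanged: now the unit vectors
      \<open>w j\<close> are measured against the orthonormal rows.\<close>
    also have "\<dots> \<le> (\<Sum>j\<in>K. \<Sum>s\<in>F. (w j s)\<^sup>2)"
      by (intro sum_mono bessel_inequality_sum[OF fin(2) finT' y_orth])
    also have "\<dots> = real (card K)"
      using w by (simp add: power2_eq_square)
    also have "\<dots> \<le> real (card J)"
      using K fin(3) by (simp add: card_mono)
    finally show ?thesis using 1 by simp
  qed
  have "(\<Sum>j\<in>J. ev j) = (\<Sum>x\<in>E. a x)"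
    unfolding ev a_def by (rule sum.swap)
  \<comment> \<open>By \<open>count\<close>, \<open>d x\<close> is the number of \<open>v\<close>
    with \<open>x \<in> T v\<close>, so \<open>d x * c x\<close> is distributed as one copy of
    \<open>c x\<close> to each such \<open>v\<close>.\<close>
  also have "\<dots> = (\<Sum>x\<in>E. \<Sum>v\<in>V. if x \<in> T v then c x else 0)"
  proof (intro sum.cong refl)
    fix x assume x: "x \<in> E"
    show "a x = (\<Sum>v\<in>V. if x \<in> T v then c x else 0)"
      using fin(4) by (simp add: a_eq[OF x] d_def count[OF x] sum.If_cases Int_def)
  qed
  also have "\<dots> = (\<Sum>v\<in>V. \<Sum>x\<in>E. if x \<in> T v then c x else 0)"
    by (rule sum.swap)
  also have "\<dots> = (\<Sum>v\<in>V. \<Sum>x\<in>T v. c x)"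
  proof (rule sum.cong[OF refl])
    fix v assume "v \<in> V"
    then have "E \<inter> T v = T v" using T by auto
    then show "(\<Sum>x\<in>E. if x \<in> T v then c x else 0) = (\<Sum>x\<in>T v. c x)"
      using sum.inter_restrict[OF fin(1), of c "T v"] by simp
  qed
  also have "\<dots> \<le> (\<Sum>v\<in>V. real (min (card (T v)) (card J)))"
    by (intro sum_mono T_le)
  finally show ?thesis .
qed

text \<open>Double counting of pairs: \<open>min (f v) k\<close> is the number of \<open>i\<close>
  in \<open>{1..k}\<close> with \<open>i \<le> f v\<close>.\<close>

lemma sum_min_eq_sum_card_ge:
  fixes f :: "'v \<Rightarrow> nat"
  assumes "finite V"
  shows "(\<Sum>v\<in>V. min (f v) k) = (\<Sum>i = 1..k. card {v \<in> V. f v \<ge> i})"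
proof -
  have "min (f v) k = (\<Sum>i = 1..k. if f v \<ge> i then 1 else 0)" for v
  proof -
    have "{i \<in> {1..k}. i \<le> f v} = {1..min (f v) k}" by auto
    then have "card {i \<in> {1..k}. i \<le> f v} = min (f v) k" by simp
    then show ?thesis
      by (simp add: sum.If_cases Int_def)
  qed
  then have "(\<Sum>v\<in>V. min (f v) k) = (\<Sum>i = 1..k. \<Sum>v\<in>V. if f v \<ge> i then 1 else 0)"
    by (simp add: sum.swap[of _ V])
  then show ?thesis
    using assms by (simp add: sum.If_cases Int_def)
qed

section \<open>Incidence signs and the Gram form of the upper Laplacian\<close>

lemma simplicesD:
  assumes "simplicial_complex V X" "s \<in> simplices X (int m - 1)"
  shows "s \<in> X" "finite s" "card s = m" "s \<subseteq> V"
  using assms finite_subset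
  by (auto simp: simplicial_complex_def simplices_def simplex_dim_def)

lemma mem_simplices_iff: "s \<in> simplices X (int m - 1) \<longleftrightarrow> s \<in> X \<and> card s = m"
  by (auto simp: simplices_def simplex_dim_def)

lemma incidence_sign_insert:
  fixes a :: "'a::linorder"
  assumes "a \<notin> s"
  shows "incidence_sign (insert a s) s = (-1) ^ card {v \<in> s. v < a}"
proof -
  have "insert a s - s = {a}" using assms by auto
  moreover have "{v \<in> insert a s. v < a} = {v \<in> s. v < a}" by auto
  ultimately show ?thesis by (simp add: incidence_sign_def)
qed

lemma incidence_sign_square: "incidence_sign s t * incidence_sign s t = 1"
  by (simp add: incidence_sign_def flip: power_add mult_2)

text \<open>Putting the smaller vertex \<open>a\<close> into \<open>p\<close> raises the number of
  vertices below \<open>b\<close> by one, while \<open>b\<close> does not affect the count for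
  \<open>a\<close>; so exactly one sign flips. Up to moving signs across, this is the identity that
  the boundary of a boundary vanishes.\<close>

lemma incidence_sign_swap_aux:
  fixes a b :: "'a::linorder"
  assumes "finite p" "a \<notin> p" "b \<notin> p" "a < b"
  shows "incidence_sign (insert a (insert b p)) (insert a p) * incidence_sign (insert a (insert b p)) (insert b p)
    = - (incidence_sign (insert a p) p * incidence_sign (insert b p) p)"
proof -
  have "{v \<in> insert a p. v < b} = insert a {v \<in> p. v < b}" using assms by auto
  then have 1: "card {v \<in> insert a p. v < b} = Suc (card {v \<in> p. v < b})" using assms by simp
  have 2: "{v \<in> insert b p. v < a} = {v \<in> p. v < a}" using assms by auto
  have "incidence_sign (insert b (insert a p)) (insert a p) = (-1) ^ card {v \<in> insert a p. v < b}"
    using assms by (intro incidence_sign_insert) auto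
  moreover have "incidence_sign (insert a (insert b p)) (insert b p) = (-1) ^ card {v \<in> insert b p. v < a}"
    using assms by (intro incidence_sign_insert) auto
  moreover have "incidence_sign (insert a p) p = (-1) ^ card {v \<in> p. v < a}"
    "incidence_sign (insert b p) p = (-1) ^ card {v \<in> p. v < b}"
    using assms by (intro incidence_sign_insert; simp)+
  ultimately show ?thesis
    unfolding insert_commute[of a b] 1 2 by simp
qed

lemma incidence_sign_swap:
  fixes a b :: "'a::linorder"
  assumes "finite p" "a \<notin> p" "b \<notin> p" "a \<noteq> b"
  shows "incidence_sign (insert a (insert b p)) (insert a p) * incidence_sign (insert a (insert b p)) (insert b p)
    = - (incidence_sign (insert a p) p * incidence_sign (insert b p) p)"
proof (cases "a < b")
  case True
  then show ?thesis using incidence_sign_swap_aux assms by blast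
next
  case False
  then have "b < a" using assms by simp
  then show ?thesis
    using incidence_sign_swap_aux[of p b a] assms by (simp add: insert_commute mult.commute)
qed

definition boundary_coeff :: "'a::linorder set \<Rightarrow> 'a set \<Rightarrow> real" where
  "boundary_coeff t s = (if t \<subseteq> s then incidence_sign s t else 0)"

lemma boundary_coeff_unit: "boundary_coeff t s \<in> {-1, 0, 1}"
  by (auto simp: boundary_coeff_def incidence_sign_def minus_one_power_iff)

lemma boundary_coeff_eq_0_iff: "boundary_coeff t s = 0 \<longleftrightarrow> \<not> t \<subseteq> s"
  by (auto simp: boundary_coeff_def incidence_sign_def)

text \<open>On the diagonal every coface contributes 1. Off the diagonal the only possible common
  coface is the union, and \<open>incidence_sign_swap\<close> exchanges its signs for those over the
  intersection, producing the minus sign of the Laplacian.\<close>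

lemma upper_laplacian_eq_gram:
  fixes X :: "'a::linorder set set"
  assumes X: "simplicial_complex V X" and r: "r \<ge> 1"
    and t: "t \<in> simplices X (int r - 1)" and e: "e \<in> simplices X (int r - 1)"
  shows "upper_laplacian X r t e = (\<Sum>s\<in>simplices X (int r). boundary_coeff t s * boundary_coeff e s)"
proof -
  let ?F = "simplices X (int r)"
  have F: "?F = simplices X (int (Suc r) - 1)" by simp
  note FD = simplicesD[OF X, of _ "Suc r", folded F]
  have fin: "finite ?F"
    using X by (auto simp: simplicial_complex_def simplices_def intro: finite_subset[of _ "Pow V"])
  note tD = simplicesD[OF X t] and eD = simplicesD[OF X e]
  show ?thesis
  proof (cases "t = e")
    case True
    have "(\<Sum>s\<in>?F. boundary_coeff t s * boundary_coeff e s) = (\<Sum>s\<in>?F. if t \<subseteq> s then 1 else 0)"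
      by (intro sum.cong) (auto simp: True boundary_coeff_def incidence_sign_square)
    then show ?thesis
      using fin True by (simp add: upper_laplacian_def degree_of_def sum.If_cases Int_def)
  next
    case neq: False
    \<comment> \<open>The union properly contains \<open>t\<close>, which has \<open>r\<close>
      vertices, and lies in \<open>s\<close>, which has \<open>r + 1\<close>; hence it is all of
      \<open>s\<close>.\<close>
    have union: "s = t \<union> e \<and> card (t \<inter> e) = r - 1" if s: "s \<in> ?F" "t \<subseteq> s" "e \<subseteq> s" for s
    proof -
      have "t \<noteq> t \<union> e" using neq tD eD card_subset_eq[of t e] by (metis Un_upper2)
      then have "card t < card (t \<union> e)" using tD eD by (intro psubset_card_mono) auto
      moreover have "card (t \<union> e) \<le> card s" using s FD by (intro card_mono) auto
      ultimately have "card (t \<union> e) = Suc r" using tD FD[OF s(1)] by simp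
      then have "t \<union> e = s" using s FD[OF s(1)] by (intro card_subset_eq) auto
      moreover have "card (t \<inter> e) = r - 1"
        using card_Un_Int[of t e] tD eD \<open>card (t \<union> e) = Suc r\<close> by simp
      ultimately show ?thesis by simp
    qed
    show ?thesis
    proof (cases "card (t \<inter> e) = r - 1 \<and> t \<union> e \<in> X")
      case True
      define p where "p = t \<inter> e"
      \<comment> \<open>Since \<open>r \<ge> 1\<close>, the natural-number difference
        \<open>r - 1\<close> is not truncated, so each of \<open>t\<close> and \<open>e\<close> has
        exactly one vertex outside the intersection.\<close>
      have "card (t - e) = 1" "card (e - t) = 1"
        using card_Diff_subset_Int[of t e] card_Diff_subset_Int[of e t] True tD eD r
        by (simp_all add: Int_commute)
      then obtain a b where "t - e = {a}" "e - t = {b}"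
        by (metis card_1_singletonE)
      then have ab: "t = insert a p" "e = insert b p" "a \<notin> p" "b \<notin> p" "a \<noteq> b" "finite p"
        using tD(2) by (auto simp: p_def)
      have un: "t \<union> e = insert a (insert b p)" using ab by auto
      have "card (t \<union> e) = Suc r"
        using card_Un_Int[of t e] tD eD True r by simp
      then have mem: "t \<union> e \<in> ?F"
        using True unfolding F mem_simplices_iff by simp
      have "(\<Sum>s\<in>?F. boundary_coeff t s * boundary_coeff e s)
          = (\<Sum>s\<in>?F. if s = t \<union> e then incidence_sign s t * incidence_sign s e else 0)"
      proof (intro sum.cong refl)
        fix s assume s: "s \<in> ?F"
        show "boundary_coeff t s * boundary_coeff e s
          = (if s = t \<union> e then incidence_sign s t * incidence_sign s e else 0)"
        proof (cases "t \<subseteq> s \<and> e \<subseteq> s")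
          case True
          then have "s = t \<union> e" using union[OF s] by blast
          then show ?thesis using True by (simp add: boundary_coeff_def)
        next
          case False
          then have "s \<noteq> t \<union> e" by blast
          then show ?thesis using False by (auto simp: boundary_coeff_def)
        qed
      qed
      also have "\<dots> = incidence_sign (t \<union> e) t * incidence_sign (t \<union> e) e"
        using fin mem by simp
      also have "\<dots> = - (incidence_sign t p * incidence_sign e p)"
        using incidence_sign_swap[of p a b] ab unfolding un by simp
      finally show ?thesis
        using neq True by (simp add: upper_laplacian_def p_def)
    next
      case False
      have "boundary_coeff t s * boundary_coeff e s = 0" if "s \<in> ?F" for s
      proof (rule ccontr)
        assume "boundary_coeff t s * boundary_coeff e s \<noteq> 0"
        then have "t \<subseteq> s" "e \<subseteq> s"
          by (metis boundary_coeff_eq_0_iff mult_zero_left mult_zero_right)+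
        then have "s = t \<union> e" "card (t \<inter> e) = r - 1" using union[OF that] by blast+
        then show False using False FD(1)[OF that] by blast
      qed
      then have "(\<Sum>s\<in>?F. boundary_coeff t s * boundary_coeff e s) = 0"
        by (rule sum.neutral[OF ballI])
      then show ?thesis
        by (simp only: upper_laplacian_def neq False if_False)
    qed
  qed
qed

section \<open>Vertex links and the partite condition\<close>

definition link_faces :: "'a set set \<Rightarrow> nat \<Rightarrow> 'a \<Rightarrow> 'a set set" where
  "link_faces X r v = {t \<in> simplices X (int r - 1). v \<notin> t \<and> insert v t \<in> simplices X (int r)}"

lemma card_link_faces:
  assumes X: "simplicial_complex V X"
  shows "card (link_faces X r v) = degree_of X r {v}"
proof -
  have F: "simplices X (int r) = simplices X (int (Suc r) - 1)" by simp
  have "bij_betw (insert v) (link_faces X r v) {s \<in> simplices X (int r). {v} \<subseteq> s}"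
  proof (intro bij_betw_byWitness[where f' = "\<lambda>s. s - {v}"])
    have "s - {v} \<in> X" if "s \<in> X" for s
      using X that by (auto simp: simplicial_complex_def)
    then show "(\<lambda>s. s - {v}) ` {s \<in> simplices X (int r). {v} \<subseteq> s} \<subseteq> link_faces X r v"
      using simplicesD(2)[OF X]
      by (auto simp: link_faces_def F mem_simplices_iff insert_absorb simp del: of_nat_Suc)
  qed (auto simp: link_faces_def)
  then show ?thesis
    unfolding degree_of_def by (rule bij_betw_same_card)
qed

text \<open>A coface of dimension \<open>r\<close> is determined by the single vertex it adds to
  \<open>t\<close>. This supplies the assumption \<open>count\<close> of the Gram bound.\<close>

lemma card_cofaces_eq_card_link_vertices:
  assumes X: "simplicial_complex V X" and t: "t \<in> simplices X (int r - 1)"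
  shows "card {s \<in> simplices X (int r). t \<subseteq> s} = card {v \<in> V. t \<in> link_faces X r v}"
proof -
  have F: "simplices X (int r) = simplices X (int (Suc r) - 1)" by simp
  note FD = simplicesD[OF X, of _ "Suc r", folded F] and tD = simplicesD[OF X t]
  have "bij_betw (\<lambda>v. insert v t) {v \<in> V. t \<in> link_faces X r v} {s \<in> simplices X (int r). t \<subseteq> s}"
  proof (intro bij_betw_imageI inj_onI)
    show "v = w" if "v \<in> {v \<in> V. t \<in> link_faces X r v}" "w \<in> {v \<in> V. t \<in> link_faces X r v}"
      "insert v t = insert w t" for v w
      using that by (auto simp: link_faces_def)
    show "(\<lambda>v. insert v t) ` {v \<in> V. t \<in> link_faces X r v} = {s \<in> simplices X (int r). t \<subseteq> s}"
    proof (intro equalityI subsetI)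
      fix s assume "s \<in> {s \<in> simplices X (int r). t \<subseteq> s}"
      then have s: "s \<in> simplices X (int r)" "t \<subseteq> s" by auto
      then have "card (s - t) = 1" using FD[OF s(1)] tD by (simp add: card_Diff_subset)
      then obtain v where "s - t = {v}" by (metis card_1_singletonE)
      then have "s = insert v t" "v \<notin> t" "v \<in> s" using s by auto
      then show "s \<in> (\<lambda>v. insert v t) ` {v \<in> V. t \<in> link_faces X r v}"
        using s(1) FD(4)[OF s(1)] t by (auto simp: link_faces_def)
    qed (auto simp: link_faces_def)
  qed
  then show ?thesis by (metis bij_betw_same_card)
qed

text \<open>Pigeonhole: if \<open>s\<close> missed \<open>A\<close>, its \<open>r + 1\<close>
  vertices would lie in the \<open>r\<close> other blocks, with at most one in each.\<close>

lemma partite_facet_meets_block: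
  assumes X: "simplicial_complex V X" and P: "partition_on V P" "card P = r + 1"
    and le: "\<And>\<sigma> A. \<sigma> \<in> X \<Longrightarrow> A \<in> P \<Longrightarrow> card (\<sigma> \<inter> A) \<le> 1"
    and s: "s \<in> simplices X (int r)" and A: "A \<in> P"
  shows "s \<inter> A \<noteq> {}"
proof
  assume empty: "s \<inter> A = {}"
  have "s \<in> simplices X (int (Suc r) - 1)" using s by simp
  note sD = simplicesD[OF X this]
  have finP: "finite P" using P(2) by (intro card_ge_0_finite) simp
  have "s = (\<Union>B\<in>P - {A}. s \<inter> B)"
    using sD(4) P(1) empty by (auto simp: partition_on_def)
  then have "card s \<le> (\<Sum>B\<in>P - {A}. card (s \<inter> B))"
    using card_UN_le[of "P - {A}" "\<lambda>B. s \<inter> B"] finP by simp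
  also have "\<dots> \<le> (\<Sum>B\<in>P - {A}. 1)"
    using le sD(1) by (intro sum_mono) auto
  also have "\<dots> = r" using finP A P(2) by simp
  finally show False using sD(3) by simp
qed

text \<open>In the simplex \<open>insert v t\<close> the vertex \<open>v\<close> already occupies
  its block \<open>A\<close>, so \<open>t\<close> avoids \<open>A\<close> and lies in
  \<open>s - A\<close>. As \<open>s\<close> meets \<open>A\<close>, that set has at most
  \<open>r\<close> elements, which forces \<open>t = s - A\<close>.\<close>

lemma partite_link_face_unique:
  assumes X: "simplicial_complex V X" and part: "partite V X (r + 1)" and v: "v \<in> V"
    and s: "s \<in> simplices X (int r)"
    and t: "t \<in> link_faces X r v" "t \<subseteq> s" and t': "t' \<in> link_faces X r v" "t' \<subseteq> s"
  shows "t = t'"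
proof -
  obtain P where P: "partition_on V P" "card P = r + 1"
    and le: "\<And>\<sigma> A. \<sigma> \<in> X \<Longrightarrow> A \<in> P \<Longrightarrow> card (\<sigma> \<inter> A) \<le> 1"
    using part by (auto simp: partite_def)
  obtain A where A: "A \<in> P" "v \<in> A"
    using v P(1) by (auto simp: partition_on_def)
  have s': "s \<in> simplices X (int (Suc r) - 1)" using s by simp
  note sD = simplicesD[OF X s']
  have "s \<inter> A \<noteq> {}" using partite_facet_meets_block[OF X P le s A(1)] by blast
  then have "s - A \<subset> s" by auto
  then have "card (s - A) < card s" using sD(2) by (intro psubset_card_mono)
  then have card: "card (s - A) \<le> r" using sD(3) by simp
  have "x = s - A" if x: "x \<in> link_faces X r v" "x \<subseteq> s" for x
  proof -
    have xE: "x \<in> simplices X (int r - 1)" and vx: "v \<notin> x" "insert v x \<in> X"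
      using x(1) by (auto simp: link_faces_def simplices_def)
    note xD = simplicesD[OF X xE]
    have "x \<inter> A = {}"
    proof (rule ccontr)
      assume "x \<inter> A \<noteq> {}"
      then obtain y where y: "y \<in> x" "y \<in> A" by auto
      then have "card {v, y} \<le> card (insert v x \<inter> A)"
        using A xD(2) by (intro card_mono) auto
      moreover have "card {v, y} = 2" using y vx(1) by (metis card_2_iff)
      ultimately show False using le[OF vx(2) A(1)] by simp
    qed
    then have "x \<subseteq> s - A" using x(2) by auto
    then show ?thesis using card xD(3) sD(2) by (intro card_seteq) auto
  qed
  then show ?thesis using t t' by metis
qed

section \<open>The eigenvalue bound for partite complexes\<close>

theorem corollary1p10:
  fixes V :: "'a::linorder set" and X :: "'a set set" and r k :: nat
    and es :: "'a set list"
  assumes "r \<ge> 1"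
    and "simplicial_complex V X"
    and "complex_dim X = int r"
    and "partite V X (r + 1)"
    and "distinct es" and "set es = simplices X (int r - 1)"
    and "1 \<le> k" and "k \<le> card (simplices X (int r - 1))"
  shows "(\<Sum>i = 1..k. nth_largest_eigenvalue (mat_of_kernel es (upper_laplacian X r)) i)
    \<le> (\<Sum>i = 1..k. real (card {v \<in> V. degree_of X r {v} \<ge> i}))"
proof -
  note X = assms(2)
  let ?E = "simplices X (int r - 1)" and ?F = "simplices X (int r)"
  let ?L = "upper_laplacian X r"
  let ?ev = "nth_largest_eigenvalue (mat_of_kernel es ?L)"
  have finV: "finite V" and finX: "finite X"
    using X by (auto simp: simplicial_complex_def intro: finite_subset[of _ "Pow V"])
  have finE: "finite ?E" and finF: "finite ?F"
    using finX by (auto simp: simplices_def)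
  note gram = upper_laplacian_eq_gram[OF X assms(1)]
  have len: "length es = card ?E"
    using distinct_card[OF assms(5)] assms(6) by simp
  have sym: "?L x y = ?L y x" if "x \<in> set es" "y \<in> set es" for x y
    using gram[of x y] gram[of y x] that assms(6) by (simp add: mult.commute)
  obtain u :: "nat \<Rightarrow> 'a set \<Rightarrow> real" where
    orth: "\<And>i j. i \<in> {1..length es} \<Longrightarrow> j \<in> {1..length es} \<Longrightarrow>
      (\<Sum>x\<in>set es. u i x * u j x) = (if i = j then 1 else 0)" and
    eigen: "\<And>i x. i \<in> {1..length es} \<Longrightarrow> x \<in> set es \<Longrightarrow>
      (\<Sum>y\<in>set es. ?L x y * u i y) = ?ev i * u i x"
    using symmetric_kernel_eigenbasis[where f = ?L, OF assms(5) sym] by blast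
  have "(\<Sum>i = 1..k. ?ev i)
    \<le> (\<Sum>v\<in>V. real (min (card (link_faces X r v)) (card {1..k})))"
  \<comment> \<open>The indices \<open>{1..k}\<close> stay within the eigenbasis because
    \<open>k\<close> is at most the number of simplices of dimension \<open>r - 1\<close>. The sets
    \<open>T v\<close> are the link faces, whose number is the degree of \<open>v\<close>.\<close>
  proof (rule sum_gram_eigenvalues_le_sum_min[OF finE finF _ finV, where u = u and b = boundary_coeff])
    show "(\<Sum>x\<in>?E. u i x * u j x) = (if i = j then 1 else 0)" if "i \<in> {1..k}" "j \<in> {1..k}" for i j
      using orth[of i j] that assms(6,8) len by simp
    show "(\<Sum>y\<in>?E. (\<Sum>s\<in>?F. boundary_coeff x s * boundary_coeff y s) * u j y) = ?ev j * u j x"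
      if "j \<in> {1..k}" "x \<in> ?E" for j x
    proof -
      have "(\<Sum>y\<in>?E. (\<Sum>s\<in>?F. boundary_coeff x s * boundary_coeff y s) * u j y)
        = (\<Sum>y\<in>?E. ?L x y * u j y)"
        using that(2) by (intro sum.cong refl) (simp only: gram)
      also have "\<dots> = ?ev j * u j x"
        using eigen[of j x] that assms(6,8) len by simp
      finally show ?thesis .
    qed
    show "x = y" if "v \<in> V" "s \<in> ?F" "x \<in> link_faces X r v" "y \<in> link_faces X r v"
      "boundary_coeff x s \<noteq> 0" "boundary_coeff y s \<noteq> 0" for v s x y
      using partite_link_face_unique[OF X assms(4) that(1,2)] that(3-)
      by (simp add: boundary_coeff_eq_0_iff)
    show "card {s \<in> ?F. boundary_coeff x s \<noteq> 0} = card {v \<in> V. x \<in> link_faces X r v}"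
      if "x \<in> ?E" for x
      using card_cofaces_eq_card_link_vertices[OF X that] by (simp add: boundary_coeff_eq_0_iff)
  qed (use boundary_coeff_unit in \<open>auto simp: link_faces_def\<close>)
  also have "\<dots> = real (\<Sum>v\<in>V. min (degree_of X r {v}) k)"
    by (simp add: card_link_faces[OF X])
  also have "\<dots> = (\<Sum>i = 1..k. real (card {v \<in> V. degree_of X r {v} \<ge> i}))"
    by (simp add: sum_min_eq_sum_card_ge[OF finV])
  finally show ?thesis .
qed

end
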